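(* Let $L$ be a finite-dimensional semisimple Leibniz algebra over a field of characteristic zero such that $$L=(sl_2^1\oplus sl_2^2\oplus\dots\oplus sl_2^{k-1}\oplus S_k)\dot{+}I,$$ where each $sl_2^j$ is a copy of $sl_2$ and $S_k$ is a simple Lie algebra. Put $I_j=[I,sl_2^j]$ for $1\le j\le k-1$ and $I_k=[I,S_k]$. Suppose that $I_j$ is an irreducible right module over $sl_2^j$ for $j=1,\dots,k-1$ and that $I_k$ is an irreducible right module over $S_k$. Then $L$ decomposes into a direct sum of simple Leibniz algebras, namely $$L=(sl_2^1\dot{+}I_1)\oplus(sl_2^2\dot{+}I_2)\oplus\dots\oplus(sl_2^{k-1}\dot{+}I_{k-1})\oplus(S_k\dot{+}I_k).$$
   Context: A (right) Leibniz algebra is a vector space $L$ with a bilinear bracket satisfying $[x,[y,z]]=[[x,y],z]-[[x,z],y]$ for all $x,y,z\in L$. For a Leibniz algebra $L$ let $I$ denote the subspace spanned by all squares $[x,x]$, $x\in L$; it is a two-sided ideal and $L/I$ is a Lie algebra. $L$ is called semisimple if its maximal solvable ideal equals $I$. $L$ is called simple if its only (two-sided) ideals are $\{0\}$, $I$, $L$, and $[L,L]\ne I$ (with $I$ the ideal of squares of the algebra in question). Notation: $\oplus$ is the direct sum of algebras; $G\dot{+}I$ is the semidirect sum (vector space direct sum of the subalgebra $G$ and the ideal $I$). Here $sl_2^1\oplus\dots\oplus sl_2^{k-1}\oplus S_k$ is a Lie subalgebra of $L$, and $sl_2$ is the simple Lie algebra with basis $\{e,f,h\}$ and products $[e,h]=2e$,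 $[f,h]=-2f$, $[e,f]=h$ (extended antisymmetrically). The ideal $I$ and its sub-ideals are right modules over Lie subalgebras of $L$ via $(m,a)\mapsto[m,a]$. An irreducible module is a nonzero module whose only submodules are zero and itself. For subspaces $A,B$, $[A,B]$ is the span of all $[a,b]$ with $a\in A$, $b\in B$. *)

theory Defs
  imports Complex_Main "HOL-Library.Set_Algebras"
begin

text \<open>
  Right Leibniz algebras. The ambient algebra is the whole type; subalgebras, ideals and
  modules are subsets of it, so that predicates such as ``simple'' can be applied both to the
  algebra (as \<^term>\<open>UNIV\<close>) and to its subalgebras.
\<close>

locale leibniz_algebra = vector_space scale
  for scale :: "'k::field \<Rightarrow> 'v::ab_group_add \<Rightarrow> 'v" +
  fixes bracket :: "'v \<Rightarrow> 'v \<Rightarrow> 'v" ("\<lbrakk>_, _\<rbrakk>")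
  assumes linear_bracket_left: "Vector_Spaces.linear scale scale (\<lambda>x. \<lbrakk>x, y\<rbrakk>)"
    and linear_bracket_right: "Vector_Spaces.linear scale scale (\<lambda>y. \<lbrakk>x, y\<rbrakk>)"
    and leibniz_identity: "\<lbrakk>x, \<lbrakk>y, z\<rbrakk>\<rbrakk> = \<lbrakk>\<lbrakk>x, y\<rbrakk>, z\<rbrakk> - \<lbrakk>\<lbrakk>x, z\<rbrakk>, y\<rbrakk>"
begin

definition bracket_span :: "'v set \<Rightarrow> 'v set \<Rightarrow> 'v set" where
  "bracket_span A B = span {\<lbrakk>a, b\<rbrakk> | a b. a \<in> A \<and> b \<in> B}"

definition subalgebra :: "'v set \<Rightarrow> bool" where
  "subalgebra A \<longleftrightarrow> subspace A \<and> (\<forall>x\<in>A. \<forall>y\<in>A. \<lbrakk>x, y\<rbrakk> \<in> A)"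

definition ideal_of :: "'v set \<Rightarrow> 'v set \<Rightarrow> bool" where
  "ideal_of A J \<longleftrightarrow> subspace J \<and> J \<subseteq> A \<and>
     (\<forall>x\<in>J. \<forall>a\<in>A. \<lbrakk>x, a\<rbrakk> \<in> J \<and> \<lbrakk>a, x\<rbrakk> \<in> J)"

definition squares_ideal :: "'v set \<Rightarrow> 'v set" where
  "squares_ideal A = span {\<lbrakk>x, x\<rbrakk> | x. x \<in> A}"

primrec derived_series :: "'v set \<Rightarrow> nat \<Rightarrow> 'v set" where
  "derived_series A 0 = A"
| "derived_series A (Suc n) = bracket_span (derived_series A n) (derived_series A n)"

definition solvable :: "'v set \<Rightarrow> bool" where
  "solvable A \<longleftrightarrow> (\<exists>n. derived_series A n = {0})"

text \<open>``The maximal solvable ideal'' is the greatest element, with respect to inclusion, among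
  the solvable ideals.\<close>

definition is_maximal_solvable_ideal :: "'v set \<Rightarrow> 'v set \<Rightarrow> bool" where
  "is_maximal_solvable_ideal A R \<longleftrightarrow> ideal_of A R \<and> solvable R \<and>
     (\<forall>J. ideal_of A J \<and> solvable J \<longrightarrow> J \<subseteq> R)"

definition semisimple_leibniz :: "'v set \<Rightarrow> bool" where
  "semisimple_leibniz A \<longleftrightarrow> subalgebra A \<and> is_maximal_solvable_ideal A (squares_ideal A)"

definition simple_leibniz :: "'v set \<Rightarrow> bool" where
  "simple_leibniz A \<longleftrightarrow> subalgebra A \<and>
     (\<forall>J. ideal_of A J \<longrightarrow> J = {0} \<or> J = squares_ideal A \<or> J = A) \<and>
     bracket_span A A \<noteq> squares_ideal A"

definition lie_subalgebra :: "'v set \<Rightarrow> bool" where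
  "lie_subalgebra A \<longleftrightarrow> subalgebra A \<and> (\<forall>x\<in>A. \<lbrakk>x, x\<rbrakk> = 0) \<and>
     (\<forall>x\<in>A. \<forall>y\<in>A. \<forall>z\<in>A. \<lbrakk>x, \<lbrakk>y, z\<rbrakk>\<rbrakk> + \<lbrakk>y, \<lbrakk>z, x\<rbrakk>\<rbrakk> + \<lbrakk>z, \<lbrakk>x, y\<rbrakk>\<rbrakk> = 0)"

definition simple_lie :: "'v set \<Rightarrow> bool" where
  "simple_lie A \<longleftrightarrow> lie_subalgebra A \<and> bracket_span A A \<noteq> {0} \<and>
     (\<forall>J. ideal_of A J \<longrightarrow> J = {0} \<or> J = A)"

definition is_sl2 :: "'v set \<Rightarrow> bool" where
  "is_sl2 A \<longleftrightarrow> (\<exists>e f h. distinct [e, f, h] \<and> independent {e, f, h} \<and> span {e, f, h} = A \<and>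
     \<lbrakk>e, h\<rbrakk> = scale 2 e \<and> \<lbrakk>h, e\<rbrakk> = - scale 2 e \<and>
     \<lbrakk>f, h\<rbrakk> = - scale 2 f \<and> \<lbrakk>h, f\<rbrakk> = scale 2 f \<and>
     \<lbrakk>e, f\<rbrakk> = h \<and> \<lbrakk>f, e\<rbrakk> = - h \<and>
     \<lbrakk>e, e\<rbrakk> = 0 \<and> \<lbrakk>f, f\<rbrakk> = 0 \<and> \<lbrakk>h, h\<rbrakk> = 0)"

text \<open>Sums of subspaces are elementwise sums of sets, from \<^theory>\<open>HOL-Library.Set_Algebras\<close>.\<close>

definition algebra_direct_sum :: "'v set \<Rightarrow> 'i set \<Rightarrow> ('i \<Rightarrow> 'v set) \<Rightarrow> bool" where
  "algebra_direct_sum A J V \<longleftrightarrow> finite J \<and> subalgebra A \<and> (\<forall>j\<in>J. subalgebra (V j)) \<and>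
     A = (\<Sum>j\<in>J. V j) \<and>
     (\<forall>v. (\<forall>j\<in>J. v j \<in> V j) \<and> (\<Sum>j\<in>J. v j) = 0 \<longrightarrow> (\<forall>j\<in>J. v j = 0)) \<and>
     (\<forall>i\<in>J. \<forall>j\<in>J. i \<noteq> j \<longrightarrow> (\<forall>x\<in>V i. \<forall>y\<in>V j. \<lbrakk>x, y\<rbrakk> = 0))"

definition semidirect_sum :: "'v set \<Rightarrow> 'v set \<Rightarrow> 'v set \<Rightarrow> bool" where
  "semidirect_sum A G J \<longleftrightarrow> subalgebra A \<and> subalgebra G \<and> ideal_of A J \<and>
     A = G + J \<and> G \<inter> J = {0}"

text \<open>The compatibility of a right module with brackets,
  \<open>\<lbrakk>m, \<lbrakk>a, b\<rbrakk>\<rbrakk> = \<lbrakk>\<lbrakk>m, a\<rbrakk>, b\<rbrakk> - \<lbrakk>\<lbrakk>m, b\<rbrakk>, a\<rbrakk>\<close>, is an instance of the Leibniz identity.\<close>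

definition right_submodule :: "'v set \<Rightarrow> 'v set \<Rightarrow> bool" where
  "right_submodule A M \<longleftrightarrow> subspace M \<and> (\<forall>m\<in>M. \<forall>a\<in>A. \<lbrakk>m, a\<rbrakk> \<in> M)"

definition irreducible_right_module :: "'v set \<Rightarrow> 'v set \<Rightarrow> bool" where
  "irreducible_right_module A M \<longleftrightarrow> right_submodule A M \<and> M \<noteq> {0} \<and>
     (\<forall>N. right_submodule A N \<and> N \<subseteq> M \<longrightarrow> N = {0} \<or> N = M)"

end

end

theory Submission imports Defs begin

text \<open>
  Squares satisfy \<open>[g + i, g + i] = [i, g]\<close>, so \<open>I\<close> is the sum of the \<open>I\<^sub>j\<close>, and each \<open>I\<^sub>j\<close> is a
  module over every summand. For \<open>i \<noteq> j\<close> the intersection of \<open>I\<^sub>i\<close> and \<open>I\<^sub>j\<close> is zero or both are the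
  same module, irreducible over two commuting algebras, at least one of which is \<open>sl\<^sub>2\<close>. In the
  latter case \<open>e\<close> is nilpotent on the module, its kernel is stable under the other algebra, so \<open>e\<close>
  acts as zero; so do \<open>f\<close> and \<open>h = [e, f]\<close>. Since \<open>sl\<^sub>2\<close> is perfect, the module is then zero.
  Hence \<open>[I\<^sub>i, S\<^sub>j] \<subseteq> I\<^sub>i \<inter> I\<^sub>j = 0\<close>, and acting by \<open>S\<^sub>j\<close> on a relation between elements of the modules
  shows that their sum is direct.
\<close>

context leibniz_algebra
begin

section \<open>Bilinearity of the bracket and spans of brackets\<close>

lemmas module_hom_bracket_left = linear_bracket_left[unfolded linear_iff_module_hom]
lemmas module_hom_bracket_right = linear_bracket_right[unfolded linear_iff_module_hom]

lemmas bracket_add_left = module_hom.add[OF module_hom_bracket_left]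
lemmas bracket_diff_left = module_hom.diff[OF module_hom_bracket_left]
lemmas bracket_scale_left = module_hom.scale[OF module_hom_bracket_left]
lemmas bracket_sum_left = module_hom.sum[OF module_hom_bracket_left]
lemmas bracket_zero_left [simp] = module_hom.zero[OF module_hom_bracket_left]
lemmas bracket_add_right = module_hom.add[OF module_hom_bracket_right]
lemmas bracket_scale_right = module_hom.scale[OF module_hom_bracket_right]
lemmas bracket_sum_right = module_hom.sum[OF module_hom_bracket_right]
lemmas bracket_zero_right [simp] = module_hom.zero[OF module_hom_bracket_right]

lemmas bracket_right_eq_0_on_span = module_hom.eq_0_on_span[OF module_hom_bracket_right]

text \<open>The Leibniz identity read as a derivation rule: right multiplication by \<open>z\<close>
  is a derivation. This orientation moves \<open>z\<close> past \<open>y\<close>, which suits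
  arguments about commuting right actions.\<close>

lemma bracket_bracket_left: "\<lbrakk>\<lbrakk>x, y\<rbrakk>, z\<rbrakk> = \<lbrakk>\<lbrakk>x, z\<rbrakk>, y\<rbrakk> + \<lbrakk>x, \<lbrakk>y, z\<rbrakk>\<rbrakk>"
  by (simp add: leibniz_identity)

lemma bracket_in_bracket_span: "a \<in> A \<Longrightarrow> b \<in> B \<Longrightarrow> \<lbrakk>a, b\<rbrakk> \<in> bracket_span A B"
  unfolding bracket_span_def by (rule span_base) blast

lemma bracket_span_subset:
  assumes "subspace C" "\<And>a b. a \<in> A \<Longrightarrow> b \<in> B \<Longrightarrow> \<lbrakk>a, b\<rbrakk> \<in> C"
  shows "bracket_span A B \<subseteq> C"
  unfolding bracket_span_def using assms by (intro span_minimal) auto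

lemma subspace_bracket_span [simp]: "subspace (bracket_span A B)"
  by (simp add: bracket_span_def)

text \<open>For \<open>y = z\<close> the two terms of the Leibniz identity cancel, so squares
  annihilate from the right; linearity extends this to their span.\<close>

lemma bracket_right_squares_ideal:
  assumes "y \<in> squares_ideal A"
  shows "\<lbrakk>x, y\<rbrakk> = 0"
  by (rule bracket_right_eq_0_on_span[OF _ assms[unfolded squares_ideal_def]])
    (auto simp: leibniz_identity)

section \<open>Elementwise sums of subspaces\<close>

lemma subspace_set_plus: "subspace A \<Longrightarrow> subspace B \<Longrightarrow> subspace (A + B)"
  by (rule back_subst[where P = subspace, OF subspace_sums[of A B]]) (auto simp: set_plus_def)

lemma subspace_sum_sets:
  assumes "finite J" "\<And>j. j \<in> J \<Longrightarrow> subspace (V j)"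
  shows "subspace (\<Sum>j\<in>J. V j)"
  using assms by (induction J rule: finite_induct) (auto simp: set_zero intro: subspace_set_plus)

lemma member_sum_sets:
  assumes "finite J" "\<And>j. j \<in> J \<Longrightarrow> subspace (V j)" "i \<in> J" "x \<in> V i"
  shows "x \<in> (\<Sum>j\<in>J. V j)"
proof -
  have "x = (\<Sum>j\<in>J. if j = i then x else 0)"
    using assms by simp
  moreover have "\<forall>j\<in>J. (if j = i then x else 0) \<in> V j"
    using assms by (auto intro: subspace_0)
  ultimately show ?thesis
    unfolding set_sum_alt[OF assms(1)] by blast
qed

section \<open>Perfect algebras and modules generated by brackets\<close>

text \<open>Every \<open>a\<close> in \<open>A\<close> is a combination of brackets of elements
  \<open>b\<close>, \<open>c\<close> of \<open>A\<close>, and the Leibniz identity turns the action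
  of such a bracket on \<open>x\<close> into actions on elements of \<open>bracket_span N A\<close>,
  which are trivial. So a nonzero module of this form carries a nontrivial action.\<close>

lemma bracket_span_perfect_trivial_action:
  assumes perfect: "bracket_span A A = A"
    and trivial: "\<And>m a. m \<in> bracket_span N A \<Longrightarrow> a \<in> A \<Longrightarrow> \<lbrakk>m, a\<rbrakk> = 0"
  shows "bracket_span N A = {0}"
proof -
  have "\<lbrakk>x, a\<rbrakk> = 0" if x: "x \<in> N" and a: "a \<in> A" for x a
  proof -
    have "a \<in> span {\<lbrakk>b, c\<rbrakk> | b c. b \<in> A \<and> c \<in> A}"
      using a perfect by (simp add: bracket_span_def)
    then show ?thesis
      by (rule bracket_right_eq_0_on_span[rotated])
        (auto simp: leibniz_identity trivial bracket_in_bracket_span x)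
  qed
  then have "bracket_span N A \<subseteq> {0}"
    by (intro bracket_span_subset) auto
  then show ?thesis
    by (metis subspace_bracket_span subspace_0 empty_iff subset_singletonD)
qed

lemma simple_lie_perfect:
  assumes "simple_lie A"
  shows "bracket_span A A = A"
proof -
  have sub: "subspace A" "\<And>x y. x \<in> A \<Longrightarrow> y \<in> A \<Longrightarrow> \<lbrakk>x, y\<rbrakk> \<in> A"
    using assms by (auto simp: simple_lie_def lie_subalgebra_def subalgebra_def)
  then have le: "bracket_span A A \<subseteq> A"
    by (intro bracket_span_subset)
  then have "ideal_of A (bracket_span A A)"
    by (auto simp: ideal_of_def intro: bracket_in_bracket_span)
  then show ?thesis
    using assms by (auto simp: simple_lie_def)
qed

text \<open>By the derivation rule, acting with \<open>b\<close> on a bracket of \<open>x\<close>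
  and \<open>a\<close> yields two brackets of the same shape. The acting \<open>B\<close> is kept
  apart from \<open>A\<close> so that every summand can act on every module.\<close>

lemma right_submodule_bracket_span:
  assumes N: "\<And>x y. x \<in> N \<Longrightarrow> \<lbrakk>x, y\<rbrakk> \<in> N"
    and A: "\<And>a b. a \<in> A \<Longrightarrow> b \<in> B \<Longrightarrow> \<lbrakk>a, b\<rbrakk> \<in> A"
  shows "right_submodule B (bracket_span N A)"
  unfolding right_submodule_def
proof (intro conjI ballI)
  fix m b
  assume m: "m \<in> bracket_span N A" and b: "b \<in> B"
  have "subspace {m. \<lbrakk>m, b\<rbrakk> \<in> bracket_span N A}"
    by (rule module_hom.subspace_linear_preimage[OF module_hom_bracket_left]) simp
  moreover have "\<lbrakk>\<lbrakk>x, a\<rbrakk>, b\<rbrakk> \<in> bracket_span N A" if "x \<in> N" "a \<in> A" for x a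
    unfolding bracket_bracket_left[of x a b]
    using that b N A by (intro subspace_add bracket_in_bracket_span) auto
  ultimately show "\<lbrakk>m, b\<rbrakk> \<in> bracket_span N A"
    using bracket_span_subset[of "{m. \<lbrakk>m, b\<rbrakk> \<in> bracket_span N A}" N A] m by auto
qed simp

section \<open>Semidirect sums of a Lie algebra and a right module\<close>

lemma semidirect_sum_right_module:
  assumes A: "lie_subalgebra A" and M: "right_submodule A M"
    and disj: "A \<inter> M = {0}" and ann: "\<And>x m. m \<in> M \<Longrightarrow> \<lbrakk>x, m\<rbrakk> = 0"
  shows "semidirect_sum (A + M) A M"
proof -
  have subA: "subspace A" and brA: "\<And>x y. x \<in> A \<Longrightarrow> y \<in> A \<Longrightarrow> \<lbrakk>x, y\<rbrakk> \<in> A"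
    using A by (auto simp: lie_subalgebra_def subalgebra_def)
  have subM: "subspace M" and brM: "\<And>x y. x \<in> M \<Longrightarrow> y \<in> A \<Longrightarrow> \<lbrakk>x, y\<rbrakk> \<in> M"
    using M by (auto simp: right_submodule_def)
  have "subalgebra (A + M)"
    unfolding subalgebra_def
  proof (intro conjI ballI)
    show "subspace (A + M)" by (rule subspace_set_plus[OF subA subM])
    fix x y assume "x \<in> A + M" "y \<in> A + M"
    then obtain a m b n where "x = a + m" "y = b + n" "a \<in> A" "b \<in> A" "m \<in> M" "n \<in> M"
      by (auto simp: set_plus_def)
    then show "\<lbrakk>x, y\<rbrakk> \<in> A + M"
      by (auto simp: bracket_add_left bracket_add_right ann brA brM)
  qed
  moreover have "M \<subseteq> A + M"
    using set_zero_plus2 subspace_0[OF subA] by blast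
  moreover have "\<lbrakk>m, x\<rbrakk> \<in> M" if "m \<in> M" "x \<in> A + M" for m x
    using that by (auto simp: set_plus_def bracket_add_right ann brM)
  ultimately show ?thesis
    using A disj subM by (auto simp: semidirect_sum_def ideal_of_def lie_subalgebra_def ann subspace_0)
qed

text \<open>An ideal \<open>J\<close> is controlled by \<open>J \<inter> M\<close> and by its projection \<open>P\<close> to \<open>A\<close>.\<close>

lemma simple_leibniz_semidirect:
  assumes A: "simple_lie A" and M: "irreducible_right_module A M"
    and disj: "A \<inter> M = {0}" and ann: "\<And>x m. m \<in> M \<Longrightarrow> \<lbrakk>x, m\<rbrakk> = 0"
    and nontrivial: "n \<in> M" "b \<in> A" "\<lbrakk>n, b\<rbrakk> \<noteq> 0"
  shows "simple_leibniz (A + M)"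
proof -
  have subA: "subspace A" and brA: "\<And>x y. x \<in> A \<Longrightarrow> y \<in> A \<Longrightarrow> \<lbrakk>x, y\<rbrakk> \<in> A"
    and sq: "\<And>x. x \<in> A \<Longrightarrow> \<lbrakk>x, x\<rbrakk> = 0" and lieA: "lie_subalgebra A"
    using A by (auto simp: simple_lie_def lie_subalgebra_def subalgebra_def)
  have subM: "subspace M" and brM: "\<And>x y. x \<in> M \<Longrightarrow> y \<in> A \<Longrightarrow> \<lbrakk>x, y\<rbrakk> \<in> M" and modM: "right_submodule A M"
    using M by (auto simp: irreducible_right_module_def right_submodule_def)
  have semi: "semidirect_sum (A + M) A M"
    by (rule semidirect_sum_right_module[OF lieA modM disj ann])
  have A_le: "A \<subseteq> A + M" and M_le: "M \<subseteq> A + M"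
    using set_zero_plus2[OF subspace_0[OF subM], of A] set_zero_plus2[OF subspace_0[OF subA], of M]
    by (simp_all add: add.commute)
  have irred: "N = {0} \<or> N = M" if "right_submodule A N" "N \<subseteq> M" for N
    using M that by (auto simp: irreducible_right_module_def)
  have squares: "squares_ideal (A + M) = M"
  proof -
    have in_M: "\<lbrakk>x, x\<rbrakk> \<in> M" if "x \<in> A + M" for x
      using that by (auto simp: set_plus_def bracket_add_left bracket_add_right ann sq brM)
    then have le: "squares_ideal (A + M) \<subseteq> M"
      unfolding squares_ideal_def by (intro span_minimal subM) auto
    have act: "\<lbrakk>m, a\<rbrakk> \<in> squares_ideal (A + M)" if "m \<in> M" "a \<in> A" for m a
    proof -
      \<comment> \<open>All other terms of the square vanish, so the module action is realised by
        squares.\<close>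
      have "\<lbrakk>a + m, a + m\<rbrakk> = \<lbrakk>m, a\<rbrakk>"
        using that by (simp add: bracket_add_left bracket_add_right ann sq)
      moreover have "a + m \<in> A + M" using that by blast
      ultimately show ?thesis
        unfolding squares_ideal_def by (intro span_base) force
    qed
    have "right_submodule A (squares_ideal (A + M))"
      unfolding right_submodule_def using act le by (auto simp: squares_ideal_def)
    then show ?thesis
      using irred[OF _ le] act[OF nontrivial(1,2)] nontrivial(3) by auto
  qed
  have "J = {0} \<or> J = M \<or> J = A + M" if J: "ideal_of (A + M) J" for J
  proof -
    have subJ: "subspace J" and J_le: "J \<subseteq> A + M"
      and Jl: "\<And>x y. x \<in> J \<Longrightarrow> y \<in> A + M \<Longrightarrow> \<lbrakk>x, y\<rbrakk> \<in> J"
      and Jr: "\<And>x y. x \<in> J \<Longrightarrow> y \<in> A + M \<Longrightarrow> \<lbrakk>y, x\<rbrakk> \<in> J"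
      using J by (auto simp: ideal_of_def)
    have "right_submodule A (J \<inter> M)"
      using subJ subM Jl A_le brM by (auto simp: right_submodule_def intro: subspace_inter)
    then have JM: "J \<inter> M = {0} \<or> J \<inter> M = M"
      by (rule irred) simp
    define P where "P = {a \<in> A. \<exists>m\<in>M. a + m \<in> J}"
    have "ideal_of A P"
      unfolding ideal_of_def
    proof (intro conjI ballI)
      show "subspace P"
      proof (rule subspaceI)
        show "0 \<in> P"
          using subspace_0[OF subA] subspace_0[OF subM] subspace_0[OF subJ] by (force simp: P_def)
      next
        fix x y assume "x \<in> P" "y \<in> P"
        then obtain m n where "m \<in> M" "n \<in> M" "x + m \<in> J" "y + n \<in> J" "x \<in> A" "y \<in> A"
          by (auto simp: P_def)
        moreover from this have "(x + y) + (m + n) \<in> J"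
          using subspace_add[OF subJ, of "x + m" "y + n"] by (simp add: algebra_simps)
        ultimately show "x + y \<in> P"
          using subspace_add[OF subA] subspace_add[OF subM] unfolding P_def by blast
      next
        fix c x assume "x \<in> P"
        then obtain m where "m \<in> M" "x + m \<in> J" "x \<in> A"
          by (auto simp: P_def)
        moreover from this have "scale c x + scale c m \<in> J"
          using subspace_scale[OF subJ, of "x + m" c] by (simp add: scale_right_distrib)
        ultimately show "scale c x \<in> P"
          using subspace_scale[OF subA] subspace_scale[OF subM] unfolding P_def by blast
      qed
      show "P \<subseteq> A" by (auto simp: P_def)
      fix x a assume "x \<in> P" and a: "a \<in> A"
      then obtain m where m: "m \<in> M" "x + m \<in> J" "x \<in> A"
        by (auto simp: P_def)
      have "\<lbrakk>x, a\<rbrakk> + \<lbrakk>m, a\<rbrakk> \<in> J"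
        using Jl[OF m(2), of a] a A_le by (auto simp: bracket_add_left)
      then show "\<lbrakk>x, a\<rbrakk> \<in> P"
        using brA[OF m(3) a] brM[OF m(1) a] by (auto simp: P_def)
      \<comment> \<open>Left multiplication by \<open>a\<close> kills \<open>m\<close>, so
        \<open>0\<close> is the element of \<open>M\<close> that witnesses membership in
        \<open>P\<close>.\<close>
      have "\<lbrakk>a, x\<rbrakk> + 0 \<in> J"
        using Jr[OF m(2), of a] a A_le by (auto simp: bracket_add_right ann[OF m(1)])
      then show "\<lbrakk>a, x\<rbrakk> \<in> P"
        using brA[OF a m(3)] subspace_0[OF subM] unfolding P_def by blast
    qed
    then consider "P = {0}" | "P = A"
      using A by (auto simp: simple_lie_def)
    then show ?thesis
    proof cases
      case 1
      have "J \<subseteq> M"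
      proof
        fix x assume "x \<in> J"
        moreover from this obtain a m where "x = a + m" "a \<in> A" "m \<in> M"
          using J_le by (auto simp: set_plus_def)
        ultimately have "a \<in> P" by (auto simp: P_def)
        then show "x \<in> M" using 1 \<open>x = a + m\<close> \<open>m \<in> M\<close> by simp
      qed
      then show ?thesis using JM by (auto simp: Int_absorb2)
    next
      case 2
      then obtain m where m: "m \<in> M" "b + m \<in> J"
        using nontrivial(2) by (auto simp: P_def)
      \<comment> \<open>Multiplying \<open>b + m\<close> by \<open>n\<close> from the left removes
        \<open>m\<close> and leaves a nonzero element of \<open>J\<close> in \<open>M\<close>;
        irreducibility then puts all of \<open>M\<close> into \<open>J\<close>.\<close>
      have "\<lbrakk>n, b\<rbrakk> \<in> J"
        using Jr[OF m(2), of n] nontrivial(1) M_le by (auto simp: bracket_add_right ann[OF m(1)])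
      then have "J \<inter> M \<noteq> {0}"
        using brM[OF nontrivial(1,2)] nontrivial(3) by auto
      then have M_J: "M \<subseteq> J" using JM by auto
      have "a \<in> J" if "a \<in> A" for a
      proof -
        obtain m where "m \<in> M" "a + m \<in> J"
          using 2 \<open>a \<in> A\<close> by (auto simp: P_def)
        then show "a \<in> J"
          using subspace_diff[OF subJ, of "a + m" m] M_J by auto
      qed
      then have "A + M \<subseteq> J"
        using M_J by (auto simp: set_plus_def intro: subspace_add[OF subJ])
      then show ?thesis using J_le by auto
    qed
  qed
  moreover have "bracket_span (A + M) (A + M) \<noteq> M"
  proof
    assume "bracket_span (A + M) (A + M) = M"
    \<comment> \<open>Otherwise brackets of elements of \<open>A\<close> would lie in both
      \<open>A\<close> and \<open>M\<close>, making \<open>A\<close> abelian.\<close>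
    then have "\<lbrakk>x, y\<rbrakk> \<in> A \<inter> M" if "x \<in> A" "y \<in> A" for x y
      using that A_le brA bracket_in_bracket_span by (metis IntI subsetD)
    then have "bracket_span A A \<subseteq> {0}"
      using disj by (intro bracket_span_subset) auto
    then have "bracket_span A A = {0}"
      by (metis subspace_bracket_span subspace_0 empty_iff subset_singletonD)
    then show False using A by (simp add: simple_lie_def)
  qed
  ultimately show ?thesis
    using semi by (simp add: simple_leibniz_def squares semidirect_sum_def)
qed

section \<open>Nilpotency of eigenvectors acting on modules\<close>

text \<open>Moving right multiplication by \<open>h\<close> past one factor \<open>e\<close> costs
  the multiple \<open>c\<close> of that factor; \<open>n\<close> factors cost
  \<open>n * c\<close>.\<close>

lemma right_power_bracket:
  assumes "\<lbrakk>e, h\<rbrakk> = scale c e"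
  shows "\<lbrakk>((\<lambda>x. \<lbrakk>x, e\<rbrakk>) ^^ n) m, h\<rbrakk> =
    ((\<lambda>x. \<lbrakk>x, e\<rbrakk>) ^^ n) \<lbrakk>m, h\<rbrakk> + scale (of_nat n * c) (((\<lambda>x. \<lbrakk>x, e\<rbrakk>) ^^ n) m)"
proof (induction n)
  case (Suc n)
  let ?x = "((\<lambda>x. \<lbrakk>x, e\<rbrakk>) ^^ n) m"
  have "\<lbrakk>\<lbrakk>?x, e\<rbrakk>, h\<rbrakk> = \<lbrakk>\<lbrakk>?x, h\<rbrakk>, e\<rbrakk> + scale c \<lbrakk>?x, e\<rbrakk>"
    by (simp add: bracket_bracket_left[of _ e h] assms bracket_scale_right)
  then show ?case
    by (simp add: Suc.IH bracket_add_left bracket_scale_left scale_left_distrib algebra_simps)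
qed simp

lemma module_hom_right_power: "module_hom scale scale ((\<lambda>x. \<lbrakk>x, e\<rbrakk>) ^^ n)"
proof (induction n)
  case 0
  show ?case using module_hom_ident by (simp add: id_def linear_iff_module_hom)
next
  case (Suc n)
  then show ?case
    using module_hom_compose[OF Suc module_hom_bracket_left[of e]] by (simp add: comp_def)
qed

end

text \<open>Characteristic zero makes the multiples \<open>n * c\<close> pairwise distinct for
  nonzero \<open>c\<close>, and the integers 2 and 8 invertible.\<close>

locale leibniz_algebra_char_0 = leibniz_algebra scale bracket
  for scale :: "'k::field_char_0 \<Rightarrow> 'v::ab_group_add \<Rightarrow> 'v"
    and bracket :: "'v \<Rightarrow> 'v \<Rightarrow> 'v"  ("\<lbrakk>_, _\<rbrakk>")
begin

text \<open>The powers of \<open>e\<close> acting on \<open>M\<close> are eigenvectors of the commutator with \<open>h\<close>, with distinct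
  eigenvalues \<open>n * c\<close>; hence those which do not vanish are linearly independent.\<close>

lemma right_powers_independent:
  assumes eh: "\<lbrakk>e, h\<rbrakk> = scale c e" "c \<noteq> 0"
    and h: "\<And>m. m \<in> M \<Longrightarrow> \<lbrakk>m, h\<rbrakk> \<in> M"
    and "finite F"
    and "\<And>m. m \<in> M \<Longrightarrow> (\<Sum>n\<in>F. scale (u n) (((\<lambda>x. \<lbrakk>x, e\<rbrakk>) ^^ n) m)) = 0"
    and "n \<in> F" "m \<in> M"
  shows "scale (u n) (((\<lambda>x. \<lbrakk>x, e\<rbrakk>) ^^ n) m) = 0"
  using \<open>finite F\<close> assms(5-7)
proof (induction F arbitrary: u n m rule: finite_induct)
  case empty
  then show ?case by simp
next
  case (insert q F)
  let ?P = "\<lambda>n. (\<lambda>x. \<lbrakk>x, e\<rbrakk>) ^^ n"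
  have rel: "(\<Sum>n\<in>F. scale (u n * (of_nat n - of_nat q)) (?P n m)) = 0" if m: "m \<in> M" for m
  proof -
    \<comment> \<open>Bracketing the relation for \<open>m\<close> with \<open>h\<close>, then
      subtracting the relation at the bracket of \<open>m\<close> with \<open>h\<close> and
      \<open>q * c\<close> times the relation at \<open>m\<close>, cancels the term \<open>q\<close>
      and multiplies the others by \<open>c * (n - q)\<close>.\<close>
    have "0 = \<lbrakk>\<Sum>n\<in>insert q F. scale (u n) (?P n m), h\<rbrakk>
        - (\<Sum>n\<in>insert q F. scale (u n) (?P n \<lbrakk>m, h\<rbrakk>))
        - scale (of_nat q * c) (\<Sum>n\<in>insert q F. scale (u n) (?P n m))"
      by (simp only: insert.prems(1)[OF m] insert.prems(1)[OF h[OF m]]) simp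
    also have "\<dots> = (\<Sum>n\<in>insert q F. scale (c * (u n * (of_nat n - of_nat q))) (?P n m))"
      unfolding bracket_sum_left scale_sum_right sum_subtractf[symmetric]
      by (intro sum.cong refl)
        (simp add: bracket_scale_left right_power_bracket[OF eh(1)] scale_right_distrib
          scale_left_diff_distrib[symmetric] right_diff_distrib left_diff_distrib ac_simps)
    also have "\<dots> = scale c (\<Sum>n\<in>F. scale (u n * (of_nat n - of_nat q)) (?P n m))"
      using insert.hyps by (simp add: scale_sum_right)
    finally show ?thesis using eh(2) by simp
  qed
  have F: "scale (u n) (?P n m) = 0" if "n \<in> F" "m \<in> M" for n m
    using insert.IH[OF rel that] insert.hyps(2) that(1) by auto
  show ?case
  proof (cases "n = q")
    case True
    have "(\<Sum>n\<in>F. scale (u n) (?P n m)) = 0"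
      using F insert.prems(3) by (intro sum.neutral) auto
    then show ?thesis
      using insert.prems(1)[OF insert.prems(3)] insert.hyps True by simp
  next
    case False
    then show ?thesis using F insert.prems by auto
  qed
qed

text \<open>Replaces Schur's lemma: the kernel of an operator commuting with an irreducible \<open>A\<close>-module is
  zero or everything. A linear relation between the vectors \<open>v, v e, v e\<^sup>2, \<dots>\<close> thus holds
  on all of \<open>M\<close>, so \<open>e\<close> is nilpotent on \<open>M\<close> and its kernel is everything.\<close>

lemma commuting_eigenvector_acts_trivially:
  assumes fd: "finite_dimensional_vector_space scale B"
    and irr: "irreducible_right_module A M"
    and comm: "\<And>a. a \<in> A \<Longrightarrow> \<lbrakk>e, a\<rbrakk> = 0"
    and eh: "\<lbrakk>e, h\<rbrakk> = scale c e" "c \<noteq> 0"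
    and e: "\<And>m. m \<in> M \<Longrightarrow> \<lbrakk>m, e\<rbrakk> \<in> M"
    and h: "\<And>m. m \<in> M \<Longrightarrow> \<lbrakk>m, h\<rbrakk> \<in> M"
    and m: "m \<in> M"
  shows "\<lbrakk>m, e\<rbrakk> = 0"
proof -
  let ?P = "\<lambda>n. (\<lambda>x. \<lbrakk>x, e\<rbrakk>) ^^ n"
  have subM: "subspace M" and brM: "\<And>m a. m \<in> M \<Longrightarrow> a \<in> A \<Longrightarrow> \<lbrakk>m, a\<rbrakk> \<in> M"
    and nz: "M \<noteq> {0}"
    using irr by (auto simp: irreducible_right_module_def right_submodule_def)
  have kernel: "(\<forall>m\<in>M. T m = 0)"
    if T: "module_hom scale scale T" "\<And>m a. a \<in> A \<Longrightarrow> T \<lbrakk>m, a\<rbrakk> = \<lbrakk>T m, a\<rbrakk>"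
      and v: "v \<in> M" "v \<noteq> 0" "T v = 0" for T v
  proof -
    have "right_submodule A ({m. T m = 0} \<inter> M)"
      using brM module_hom.subspace_kernel[OF T(1)] subM T(2)
      by (auto simp: right_submodule_def intro: subspace_inter)
    then have "{m. T m = 0} \<inter> M = {0} \<or> {m. T m = 0} \<inter> M = M"
      using irr by (auto simp: irreducible_right_module_def)
    then show ?thesis using v by blast
  qed
  have comm_e: "\<lbrakk>\<lbrakk>m, a\<rbrakk>, e\<rbrakk> = \<lbrakk>\<lbrakk>m, e\<rbrakk>, a\<rbrakk>" if "a \<in> A" for m a
    by (simp add: bracket_bracket_left[of m e a] comm[OF that])
  have comm_P: "?P n \<lbrakk>m, a\<rbrakk> = \<lbrakk>?P n m, a\<rbrakk>" if "a \<in> A" for n m a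
    by (induction n) (simp_all add: comm_e[OF that])
  have P_M: "?P n m \<in> M" if "m \<in> M" for n m
    by (induction n) (simp_all add: e that)
  obtain v where v: "v \<in> M" "v \<noteq> 0"
    using nz subspace_0[OF subM] by blast
  \<comment> \<open>The relation is indexed by exponents. If the powers applied to \<open>v\<close>
    are distinct, finite dimension gives it; if two of them coincide, their difference does.\<close>
  obtain F u q where F: "finite F" "q \<in> F" "u q \<noteq> (0::'k)"
    "(\<Sum>n\<in>F. scale (u n) (?P n v)) = 0"
  proof (cases "inj (\<lambda>n. ?P n v)")
    case True
    then have "infinite (range (\<lambda>n. ?P n v))"
      by (simp add: finite_image_iff)
    then have "dependent (range (\<lambda>n. ?P n v))"
      using finite_dimensional_vector_space.finiteI_independent[OF fd] by blast
    then obtain t u w where t: "finite t" "t \<subseteq> range (\<lambda>n. ?P n v)"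
        "(\<Sum>x\<in>t. scale (u x) x) = 0" "w \<in> t" "u w \<noteq> 0"
      unfolding dependent_explicit by blast
    then obtain F where F: "finite F" "t = (\<lambda>n. ?P n v) ` F"
      by (meson finite_subset_image)
    have "(\<Sum>x\<in>t. scale (u x) x) = (\<Sum>n\<in>F. scale (u (?P n v)) (?P n v))"
      unfolding F(2) using True by (subst sum.reindex) (auto intro: inj_on_subset)
    then show ?thesis
      using that[of F _ "\<lambda>n. u (?P n v)"] F t by auto
  next
    case False
    then obtain p q where "p \<noteq> q" "?P p v = ?P q v"
      by (auto simp: inj_on_def)
    then show ?thesis
      by (intro that[of "{p, q}" p "\<lambda>n. if n = p then 1 else -1"]) auto
  qed
  have "\<forall>m\<in>M. (\<Sum>n\<in>F. scale (u n) (?P n m)) = 0"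
  proof (rule kernel[of "\<lambda>m. \<Sum>n\<in>F. scale (u n) (?P n m)", OF _ _ v F(4)])
    show "module_hom scale scale (\<lambda>m. \<Sum>n\<in>F. scale (u n) (?P n m))"
      by (simp add: Modules.module_hom_iff module_axioms module_hom.add[OF module_hom_right_power]
          module_hom.scale[OF module_hom_right_power] scale_right_distrib sum.distrib
          scale_sum_right mult.commute)
  qed (simp add: comm_P bracket_sum_left bracket_scale_left)
  then have "scale (u q) (?P q v) = 0"
    by (intro right_powers_independent[OF eh h F(1) _ F(2) v(1)]) auto
  then have q: "?P q v = 0" using F(3) by simp
  \<comment> \<open>The least exponent that kills \<open>v\<close> is positive, as \<open>v\<close>
    is nonzero; one step below it lies a nonzero vector killed by \<open>e\<close>.\<close>
  then obtain p where p: "?P p v \<noteq> 0" "?P (Suc p) v = 0"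
    using ex_least_nat_less[of "\<lambda>n. ?P n v = 0" q] v(2) by auto
  have "\<forall>m\<in>M. \<lbrakk>m, e\<rbrakk> = 0"
  proof (rule kernel[of "\<lambda>x. \<lbrakk>x, e\<rbrakk>" "?P p v", OF _ _ P_M[OF v(1)] p(1)])
    show "module_hom scale scale (\<lambda>x. \<lbrakk>x, e\<rbrakk>)" by (rule module_hom_bracket_left)
    show "\<lbrakk>?P p v, e\<rbrakk> = 0" using p(2) by simp
  qed (rule comm_e)
  then show ?thesis using m by blast
qed

section \<open>Simplicity of sl2 and its actions\<close>

text \<open>In a nonzero ideal, bracketing an element twice with \<open>h\<close> isolates its
  \<open>e\<close> and \<open>f\<close> components. Either one of these is nonzero or the element is
  a multiple of \<open>h\<close>; each case puts \<open>h\<close>, and then \<open>e\<close> and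
  \<open>f\<close>, into the ideal.\<close>

lemma sl2_simple_lie:
  assumes sl2: "is_sl2 A" and lie: "lie_subalgebra A"
  shows "simple_lie A"
proof -
  obtain e f h where efh: "independent {e, f, h}" "distinct [e, f, h]" "span {e, f, h} = A"
      "\<lbrakk>e, h\<rbrakk> = scale 2 e" "\<lbrakk>f, h\<rbrakk> = - scale 2 f" "\<lbrakk>e, f\<rbrakk> = h" "\<lbrakk>h, h\<rbrakk> = 0" "\<lbrakk>h, f\<rbrakk> = scale 2 f"
      "\<lbrakk>h, e\<rbrakk> = - scale 2 e" "\<lbrakk>f, e\<rbrakk> = - h"
    using sl2 unfolding is_sl2_def by blast
  have in_A: "e \<in> A" "f \<in> A" "h \<in> A"
    using efh(3) by (auto intro: span_base)
  have "h \<noteq> 0" using efh(1) dependent_zero by auto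
  have "J = {0} \<or> J = A" if J: "ideal_of A J" for J
  proof (cases "J = {0}")
    case False
    have subJ: "subspace J" and J_le: "J \<subseteq> A"
      and Jl: "\<And>x y. x \<in> J \<Longrightarrow> y \<in> A \<Longrightarrow> \<lbrakk>x, y\<rbrakk> \<in> J"
      and Jr: "\<And>x y. x \<in> J \<Longrightarrow> y \<in> A \<Longrightarrow> \<lbrakk>y, x\<rbrakk> \<in> J"
      using J by (auto simp: ideal_of_def)
    have scaleD: "x \<in> J" if "scale c x \<in> J" "c \<noteq> 0" for c x
      using subspace_scale[OF subJ that(1), of "inverse c"] that(2) by simp
    obtain x where x: "x \<in> J" "x \<noteq> 0"
      using False subspace_0[OF subJ] by blast
    obtain a b c where abc: "x = scale a e + scale b f + scale c h"
    proof -
      have "x \<in> span {e, f, h}" using x J_le efh(3) by auto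
      then obtain a b c where "x - scale a e - scale b f - scale c h \<in> {0}"
        by (auto simp: span_breakdown_eq)
      then show ?thesis
        by (intro that[of a b c]) (simp add: algebra_simps)
    qed
    have xh: "\<lbrakk>x, h\<rbrakk> = scale (2 * a) e - scale (2 * b) f"
      by (simp add: abc bracket_add_left bracket_scale_left efh mult.commute)
    have xhh: "\<lbrakk>\<lbrakk>x, h\<rbrakk>, h\<rbrakk> = scale (4 * a) e + scale (4 * b) f"
      by (simp add: xh bracket_diff_left bracket_scale_left efh mult.commute)
    have J1: "\<lbrakk>x, h\<rbrakk> \<in> J" and J2: "\<lbrakk>\<lbrakk>x, h\<rbrakk>, h\<rbrakk> \<in> J"
      using Jl x(1) in_A by auto
    \<comment> \<open>The eigenvalues 2 and -2 of \<open>e\<close> and \<open>f\<close> are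
      separated by adding, and below by subtracting, twice the first bracket.\<close>
    have "scale (8 * a) e = \<lbrakk>\<lbrakk>x, h\<rbrakk>, h\<rbrakk> + scale 2 \<lbrakk>x, h\<rbrakk>"
      unfolding xhh unfolding xh by (simp add: scale_right_diff_distrib scale_left_distrib[symmetric])
    then have ea: "scale (8 * a) e \<in> J"
      using J1 J2 subJ by (simp add: subspace_add subspace_scale)
    have "scale (8 * b) f = \<lbrakk>\<lbrakk>x, h\<rbrakk>, h\<rbrakk> - scale 2 \<lbrakk>x, h\<rbrakk>"
      unfolding xhh unfolding xh by (simp add: scale_right_diff_distrib scale_left_distrib[symmetric])
    then have fb: "scale (8 * b) f \<in> J"
      using J1 J2 subJ by (simp add: subspace_diff subspace_scale)
    have "h \<in> J"
    proof (cases "a = 0 \<and> b = 0")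
      case True
      then show ?thesis using x abc scaleD[of c h] by (cases "c = 0") auto
    next
      case False
      then have "e \<in> J \<or> f \<in> J"
        using scaleD[OF ea] scaleD[OF fb] by auto
      then show ?thesis
        using Jl[of e f] Jr[of f e] in_A efh by auto
    qed
    moreover have "e \<in> J"
      using Jr[OF \<open>h \<in> J\<close> in_A(1)] efh scaleD[of 2 e] by simp
    moreover have "f \<in> J"
      using Jl[OF \<open>h \<in> J\<close> in_A(2)] efh scaleD[of 2 f] by simp
    ultimately have "A \<subseteq> J"
      unfolding efh(3)[symmetric] by (intro span_minimal subJ) auto
    then show ?thesis using J_le by auto
  qed simp
  moreover have "bracket_span A A \<noteq> {0}"
    using bracket_in_bracket_span[OF in_A(1,2)] efh \<open>h \<noteq> 0\<close> by auto
  ultimately show ?thesis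
    using lie by (simp add: simple_lie_def)
qed

text \<open>Both \<open>e\<close> and \<open>f\<close> are eigenvectors with nonzero eigenvalues for
  bracketing with \<open>h\<close>, so each acts as zero; then so does \<open>h\<close>, their
  bracket.\<close>

lemma sl2_commuting_irreducible_acts_trivially:
  assumes fd: "finite_dimensional_vector_space scale B"
    and sl2: "is_sl2 A" and irr: "irreducible_right_module C M"
    and comm: "\<And>a c. a \<in> A \<Longrightarrow> c \<in> C \<Longrightarrow> \<lbrakk>a, c\<rbrakk> = 0"
    and sub: "right_submodule A M"
    and "m \<in> M" "a \<in> A"
  shows "\<lbrakk>m, a\<rbrakk> = 0"
proof -
  obtain e f h where efh: "span {e, f, h} = A"
      "\<lbrakk>e, h\<rbrakk> = scale 2 e" "\<lbrakk>f, h\<rbrakk> = scale (-2) f" "\<lbrakk>e, f\<rbrakk> = h"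
    using sl2 unfolding is_sl2_def by auto
  have in_A: "e \<in> A" "f \<in> A" "h \<in> A"
    using efh(1) by (auto intro: span_base)
  have brM: "\<And>m a. m \<in> M \<Longrightarrow> a \<in> A \<Longrightarrow> \<lbrakk>m, a\<rbrakk> \<in> M"
    using sub by (auto simp: right_submodule_def)
  have e: "\<lbrakk>m, e\<rbrakk> = 0" if "m \<in> M" for m
    by (rule commuting_eigenvector_acts_trivially[OF fd irr _ efh(2) _ _ _ that])
      (use comm in_A brM in auto)
  have f: "\<lbrakk>m, f\<rbrakk> = 0" if "m \<in> M" for m
    by (rule commuting_eigenvector_acts_trivially[OF fd irr _ efh(3) _ _ _ that])
      (use comm in_A brM in auto)
  have h: "\<lbrakk>m, h\<rbrakk> = 0" if "m \<in> M" for m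
    using leibniz_identity[of m e f] by (simp add: efh e f that)
  show ?thesis
    using \<open>a \<in> A\<close> e[OF \<open>m \<in> M\<close>] f[OF \<open>m \<in> M\<close>] h[OF \<open>m \<in> M\<close>]
    unfolding efh(1)[symmetric] by (elim bracket_right_eq_0_on_span[rotated]) auto
qed

end

theorem theorem3p4:
  fixes scale :: "'k::field_char_0 \<Rightarrow> 'v::ab_group_add \<Rightarrow> 'v"
    and bracket :: "'v \<Rightarrow> 'v \<Rightarrow> 'v"
    and k :: nat
    and S M :: "nat \<Rightarrow> 'v set"
    and G I :: "'v set"
  assumes leibniz: "leibniz_algebra scale bracket"
    and finite_dim: "\<exists>B. finite_dimensional_vector_space scale B"
    and semisimple: "leibniz_algebra.semisimple_leibniz scale bracket UNIV"
    and I: "I = leibniz_algebra.squares_ideal scale bracket UNIV"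
    and k: "1 \<le> k"
    and sl2: "\<And>j. j \<in> {1..<k} \<Longrightarrow> leibniz_algebra.is_sl2 scale bracket (S j)"
    and simple: "leibniz_algebra.simple_lie scale bracket (S k)"
    and G: "leibniz_algebra.algebra_direct_sum scale bracket G {1..k} S"
    and G_lie: "leibniz_algebra.lie_subalgebra scale bracket G"
    and L: "leibniz_algebra.semidirect_sum scale bracket UNIV G I"
    and M: "\<And>j. j \<in> {1..k} \<Longrightarrow> M j = leibniz_algebra.bracket_span scale bracket I (S j)"
    and irreducible: "\<And>j. j \<in> {1..k} \<Longrightarrow>
          leibniz_algebra.irreducible_right_module scale bracket (S j) (M j)"
  shows "leibniz_algebra.algebra_direct_sum scale bracket UNIV {1..k} (\<lambda>j. S j + M j) \<and>
    (\<forall>j\<in>{1..k}. leibniz_algebra.semidirect_sum scale bracket (S j + M j) (S j) (M j) \<and>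
       leibniz_algebra.simple_leibniz scale bracket (S j + M j))"
proof -
  interpret leibniz_algebra scale bracket by (rule leibniz)
  interpret leibniz_algebra_char_0 scale bracket by unfold_locales
  obtain B where fd: "finite_dimensional_vector_space scale B"
    using finite_dim by blast

  \<comment> \<open>The summands and their modules\<close>
  have G_sum: "G = (\<Sum>j\<in>{1..k}. S j)"
    and S_alg: "\<And>j. j \<in> {1..k} \<Longrightarrow> subalgebra (S j)"
    and S_indep: "\<And>v j. \<lbrakk>\<And>j. j \<in> {1..k} \<Longrightarrow> v j \<in> S j; (\<Sum>j\<in>{1..k}. v j) = 0; j \<in> {1..k}\<rbrakk> \<Longrightarrow> v j = 0"
    and S_comm: "\<And>i j x y. \<lbrakk>i \<in> {1..k}; j \<in> {1..k}; i \<noteq> j; x \<in> S i; y \<in> S j\<rbrakk> \<Longrightarrow> bracket x y = 0"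
    using G unfolding algebra_direct_sum_def by blast+
  have S_sub: "\<And>j. j \<in> {1..k} \<Longrightarrow> subspace (S j)"
    using S_alg by (auto simp: subalgebra_def)
  have S_G: "S j \<subseteq> G" if "j \<in> {1..k}" for j
    unfolding G_sum using member_sum_sets[of "{1..k}" S] S_sub that by blast
  have G_sub: "subspace G"
    using G_lie by (auto simp: lie_subalgebra_def subalgebra_def)
  have S_lie: "lie_subalgebra (S j)" if "j \<in> {1..k}" for j
    using G_lie S_G[OF that] S_alg[OF that] unfolding lie_subalgebra_def by blast
  have S_simple: "simple_lie (S j)" if "j \<in> {1..k}" for j
    using that simple sl2_simple_lie[OF sl2 S_lie, of j] by (cases "j = k") auto
  have I_sub: "subspace I" and GI: "G \<inter> I = {0}" and UNIV_GI: "UNIV = G + I"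
    and I_br: "\<And>x y. x \<in> I \<Longrightarrow> bracket x y \<in> I"
    using L by (auto simp: semidirect_sum_def ideal_of_def)
  have I_ann: "bracket x y = 0" if "y \<in> I" for x y
    using that bracket_right_squares_ideal by (simp add: I)
  have M_sub: "subspace (M j)" if "j \<in> {1..k}" for j
    using M that by simp
  have M_I: "M j \<subseteq> I" if "j \<in> {1..k}" for j
    unfolding M[OF that] by (intro bracket_span_subset I_sub I_br)
  \<comment> \<open>For distinct indices the bracket of \<open>S j\<close> with \<open>S i\<close>
    is zero, hence still inside \<open>S j\<close>.\<close>
  have M_mod: "right_submodule (S i) (M j)" if "i \<in> {1..k}" "j \<in> {1..k}" for i j
    unfolding M[OF that(2)]
  proof (rule right_submodule_bracket_span[OF I_br])
    show "bracket a b \<in> S j" if "a \<in> S j" "b \<in> S i" for a b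
      using that \<open>i \<in> {1..k}\<close> \<open>j \<in> {1..k}\<close> S_alg S_comm[of j i a b] S_sub
      by (cases "i = j") (auto simp: subalgebra_def subspace_0)
  qed
  have M_nontrivial: "\<exists>m\<in>M j. \<exists>a\<in>S j. bracket m a \<noteq> 0" if j: "j \<in> {1..k}" for j
    using bracket_span_perfect_trivial_action[OF simple_lie_perfect[OF S_simple[OF j]], of I]
      irreducible[OF j] M[OF j] by (auto simp: irreducible_right_module_def)

  \<comment> \<open>Modules of distinct summands meet in zero\<close>
  have M_neq: "M i \<noteq> M j" if "i \<in> {1..k}" "j \<in> {1..k}" "i < j" for i j
  proof
    assume eq: "M i = M j"
    \<comment> \<open>From \<open>i < j\<close> it follows that \<open>i < k\<close>, so
      \<open>S i\<close> is a copy of sl2, while \<open>S j\<close> acts irreducibly on the common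
      module.\<close>
    have "bracket m a = 0" if "m \<in> M i" "a \<in> S i" for m a
      by (rule sl2_commuting_irreducible_acts_trivially[OF fd, of "S i" "S j" "M i"])
        (use that sl2 \<open>i \<in> _\<close> \<open>j \<in> _\<close> \<open>i < j\<close> irreducible[of j] eq M_mod[of i i] S_comm[of i j] in auto)
    then show False using M_nontrivial \<open>i \<in> _\<close> by blast
  qed
  have M_disj: "M i \<inter> M j = {0}" if ij: "i \<in> {1..k}" "j \<in> {1..k}" "i \<noteq> j" for i j
  proof (rule ccontr)
    assume ne: "M i \<inter> M j \<noteq> {0}"
    \<comment> \<open>The nonzero intersection is a submodule of each module over its own
      irreducibly acting algebra.\<close>
    have "M i \<inter> M j = M l" if "l = i \<or> l = j" for l
    proof -
      have l: "l \<in> {1..k}" using that ij by blast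
      have "right_submodule (S l) (M i \<inter> M j)"
        using M_mod[OF l ij(1)] M_mod[OF l ij(2)]
        by (auto simp: right_submodule_def intro: subspace_inter)
      then show ?thesis
        using irreducible[OF l] ne that unfolding irreducible_right_module_def by blast
    qed
    then have "M i = M j" by blast
    then show False using M_neq[of i j] M_neq[of j i] ij by (metis linorder_neqE_nat)
  qed
  have M_cross: "bracket m a = 0" if "i \<in> {1..k}" "j \<in> {1..k}" "i \<noteq> j" "m \<in> M i" "a \<in> S j" for i j m a
  proof -
    have "bracket m a \<in> M i"
      using M_mod[OF that(2,1)] that(4,5) by (auto simp: right_submodule_def)
    moreover have "bracket m a \<in> M j"
      using M_I[OF that(1)] that(4,5) by (auto simp: M[OF that(2)] intro: bracket_in_bracket_span)
    ultimately show ?thesis using M_disj[OF that(1-3)] by auto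
  qed

  \<comment> \<open>The ideal of squares as a direct sum of modules\<close>
  have I_sum: "I = (\<Sum>j\<in>{1..k}. M j)"
  proof
    have sub: "subspace (\<Sum>j\<in>{1..k}. M j)"
      by (rule subspace_sum_sets) (auto intro: M_sub)
    have "bracket x x \<in> (\<Sum>j\<in>{1..k}. M j)" for x
    proof -
      obtain g i where gi: "x = g + i" "g \<in> G" "i \<in> I"
        using UNIV_GI by (metis UNIV_I set_plus_elim)
      obtain s where s: "g = (\<Sum>j\<in>{1..k}. s j)" "\<And>j. j \<in> {1..k} \<Longrightarrow> s j \<in> S j"
        using gi(2) unfolding G_sum set_sum_alt[OF finite_atLeastAtMost] by blast
      have "bracket x x = bracket i g"
        using G_lie gi by (simp add: bracket_add_left bracket_add_right I_ann lie_subalgebra_def)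
      also have "\<dots> = (\<Sum>j\<in>{1..k}. bracket i (s j))"
        by (simp add: s(1) bracket_sum_right)
      also have "\<dots> \<in> (\<Sum>j\<in>{1..k}. M j)"
        using gi(3) s(2) M bracket_in_bracket_span
        unfolding set_sum_alt[OF finite_atLeastAtMost] by blast
      finally show ?thesis .
    qed
    then show "I \<subseteq> (\<Sum>j\<in>{1..k}. M j)"
      unfolding I squares_ideal_def by (intro span_minimal sub) auto
    show "(\<Sum>j\<in>{1..k}. M j) \<subseteq> I"
      unfolding set_sum_alt[OF finite_atLeastAtMost] using M_I
      by (blast intro: subspace_sum[OF I_sub])
  qed
  have M_indep: "m j = 0"
    if m: "\<And>j. j \<in> {1..k} \<Longrightarrow> m j \<in> M j" and sum0: "(\<Sum>j\<in>{1..k}. m j) = 0" and j: "j \<in> {1..k}" for m j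
  proof -
    have killed: "bracket (m j) a = 0" if a: "a \<in> S j" for a
    proof -
      have "0 = bracket (\<Sum>i\<in>{1..k}. m i) a" by (simp only: sum0 bracket_zero_left)
      also have "\<dots> = (\<Sum>i\<in>{1..k}. if i = j then bracket (m j) a else 0)"
        unfolding bracket_sum_left using M_cross[OF _ j _ m a] by (intro sum.cong) auto
      finally show ?thesis using j by simp
    qed
    \<comment> \<open>The vectors of \<open>M j\<close> annihilated by \<open>S j\<close> form a
      submodule, proper since the action is nontrivial, hence zero.\<close>
    let ?N = "{n \<in> M j. \<forall>a\<in>S j. bracket n a = 0}"
    have "right_submodule (S j) ?N"
      using M_sub[OF j] M_mod[OF j j]
      by (auto simp: right_submodule_def subspace_def bracket_add_left bracket_scale_left)
    then have "?N = {0} \<or> ?N = M j"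
      using irreducible[OF j] by (auto simp: irreducible_right_module_def)
    moreover have "?N \<noteq> M j" using M_nontrivial[OF j] by blast
    ultimately show ?thesis using killed m[OF j] by blast
  qed

  \<comment> \<open>Assembling the simple summands\<close>
  have S_M: "S j \<inter> M j = {0}" if "j \<in> {1..k}" for j
    using S_G[OF that] M_I[OF that] GI subspace_0[OF S_sub[OF that]] subspace_0[OF M_sub[OF that]]
    by blast
  have M_ann: "bracket x m = 0" if "j \<in> {1..k}" "m \<in> M j" for j x m
    using M_I that I_ann by blast
  have summand: "semidirect_sum (S j + M j) (S j) (M j) \<and> simple_leibniz (S j + M j)"
    if j: "j \<in> {1..k}" for j
    using semidirect_sum_right_module[OF S_lie[OF j] M_mod[OF j j] S_M[OF j] M_ann[OF j]]
      simple_leibniz_semidirect[OF S_simple[OF j] irreducible[OF j] S_M[OF j] M_ann[OF j]]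
      M_nontrivial[OF j] by blast
  have "algebra_direct_sum UNIV {1..k} (\<lambda>j. S j + M j)"
    unfolding algebra_direct_sum_def
  proof (intro conjI ballI allI impI)
    show "subalgebra UNIV" by (simp add: subalgebra_def)
    show "subalgebra (S j + M j)" if "j \<in> {1..k}" for j
      using summand[OF that] by (simp add: semidirect_sum_def)
    \<comment> \<open>Elementwise addition of sets is a commutative monoid, so the sum splits into
      \<open>G\<close> and \<open>I\<close>.\<close>
    show "UNIV = (\<Sum>j\<in>{1..k}. S j + M j)"
      by (simp only: sum.distrib G_sum[symmetric] I_sum[symmetric] UNIV_GI[symmetric])
  next
    fix v j
    assume v: "(\<forall>j\<in>{1..k}. v j \<in> S j + M j) \<and> (\<Sum>j\<in>{1..k}. v j) = 0" and j: "j \<in> {1..k}"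
    \<comment> \<open>Phrasing membership through the difference \<open>v j - s\<close> lets one
      choice function produce both components.\<close>
    have "\<forall>j\<in>{1..k}. \<exists>s. s \<in> S j \<and> v j - s \<in> M j"
    proof
      fix j assume "j \<in> {1..k}"
      with v have "v j \<in> S j + M j" by simp
      then obtain s m where "v j = s + m" "s \<in> S j" "m \<in> M j" by (rule set_plus_elim)
      then show "\<exists>s. s \<in> S j \<and> v j - s \<in> M j" by (intro exI[of _ s]) simp
    qed
    from bchoice[OF this] obtain s where s: "\<forall>j\<in>{1..k}. s j \<in> S j \<and> v j - s j \<in> M j" ..
    define m where "m j = v j - s j" for j
    have sm: "\<And>j. j \<in> {1..k} \<Longrightarrow> s j \<in> S j" "\<And>j. j \<in> {1..k} \<Longrightarrow> m j \<in> M j"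
      using s by (auto simp: m_def)
    have "(\<Sum>j\<in>{1..k}. v j) = (\<Sum>j\<in>{1..k}. s j) + (\<Sum>j\<in>{1..k}. m j)"
      unfolding sum.distrib[symmetric] m_def by simp
    with v have sum0: "(\<Sum>j\<in>{1..k}. s j) + (\<Sum>j\<in>{1..k}. m j) = 0"
      by simp
    \<comment> \<open>The sum of the \<open>s j\<close> lies in \<open>G\<close>, and as the
      negative of the sum of the \<open>m j\<close> also in \<open>I\<close>; so both sums
      vanish.\<close>
    have s_G: "(\<Sum>j\<in>{1..k}. s j) \<in> G"
      by (rule subspace_sum[OF G_sub subsetD[OF S_G sm(1)]])
    have "(\<Sum>j\<in>{1..k}. m j) \<in> I"
      by (rule subspace_sum[OF I_sub subsetD[OF M_I sm(2)]])
    from subspace_neg[OF I_sub this] have "(\<Sum>j\<in>{1..k}. s j) \<in> I"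
      using sum0 by (simp only: eq_neg_iff_add_eq_0[symmetric])
    with s_G GI have s0: "(\<Sum>j\<in>{1..k}. s j) = 0"
      by blast
    have "s j = 0"
      by (rule S_indep[OF sm(1) s0 j])
    moreover have "m j = 0"
      by (rule M_indep[OF sm(2) sum0[unfolded s0 add_0_left] j])
    ultimately show "v j = 0"
      by (simp add: m_def)
  next
    fix i j x y
    assume ij: "i \<in> {1..k}" "j \<in> {1..k}" "i \<noteq> j" and "x \<in> S i + M i" "y \<in> S j + M j"
    then obtain s m t n where "x = s + m" "s \<in> S i" "m \<in> M i" "y = t + n" "t \<in> S j" "n \<in> M j"
      by (elim set_plus_elim)
    \<comment> \<open>The terms with \<open>n\<close> on the right vanish because squares
      annihilate; the others vanish by commutation and by the trivial cross action.\<close>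
    then show "bracket x y = 0"
      using S_comm[OF ij] M_cross[OF ij] M_ann[OF ij(2)]
      by (simp add: bracket_add_left bracket_add_right)
  qed simp
  then show ?thesis using summand by (intro conjI ballI) auto
qed

end
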